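(* For every integer $n\geq 2$, the $n$th prime number $p_n$ satisfies $$p_n \leq n^{\log 3/\log 2}.$$
   Context: $p_n$ denotes the $n$th prime number, so that $p_1=2$, $p_2=3$, $p_3=5$, and so on; $\log$ is the natural logarithm. *)

theory Defs
  imports Complex_Main "HOL-Computational_Algebra.Primes" "HOL-Library.Infinite_Set"
begin

text \<open>\<^const>\<open>enumerate\<close> counts from 0, whereas the primes are numbered from 1;
  the value at 0 is a dummy.\<close>

definition nth_prime :: "nat \<Rightarrow> nat" where
  "nth_prime n = enumerate {p. prime p} (n - 1)"

lemma strict_mono_on_nth_prime: "strict_mono_on {1..} nth_prime"
  using primes_infinite by (auto simp: strict_mono_on_def nth_prime_def)

lemma nth_prime_image: "nth_prime ` {1..} = {p. prime p}"
proof -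
  have "(\<lambda>n::nat. n - 1) ` {1..} = UNIV"
    by (auto intro: image_eqI[where x = "Suc _"])
  then have "nth_prime ` {1..} = range (enumerate {p::nat. prime p})"
    unfolding nth_prime_def by (metis image_image)
  with range_enumerate[OF primes_infinite] show ?thesis by simp
qed

lemma nth_prime_1: "nth_prime 1 = 2"
  unfolding nth_prime_def
  by (simp add: enumerate_0) (rule Least_equality, auto simp: prime_ge_2_nat)

end

theory Submission
  imports Defs
begin

text \<open>
  The bound follows from the stronger inequality \<open>p\<^sub>n\<^sup>2 \<le> n\<^sup>3\<close> for \<open>n \<ge> 3\<close>, because
  \<open>9 > 8\<close> gives \<open>ln 3 / ln 2 > 3 / 2\<close>; for \<open>n = 2\<close> the two sides of the bound are both \<open>3\<close>.

  For large primes the stronger inequality comes from a Chebyshev estimate. If every number in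
  \<open>{1..N}\<close> divides \<open>M > 0\<close>, then so does every \<open>m * (N choose m)\<close> with \<open>1 \<le> m \<le> N\<close>
  (lemma \<open>dvd_imp_mult_binomial_dvd\<close>, by Leibniz' harmonic triangle). The sum of these \<open>N\<close>
  numbers is \<open>N * 2 ^ (N - 1)\<close>, hence \<open>2 ^ (N - 1) \<le> M\<close>. For \<open>M\<close> one can take a product of
  one prime power \<open>\<le> N\<close> for each prime \<open>\<le> N\<close>, so that \<open>M \<le> N ^ \<pi>(N)\<close>, where \<open>\<pi>(N)\<close> is
  the number of primes \<open>\<le> N\<close>. With \<open>N = p\<^sub>n = p\<close> this gives \<open>2 ^ (p - 1) \<le> p ^ n\<close>
  (lemma \<open>two_power_nth_prime_le\<close>).

  If \<open>2 ^ k \<le> p < 2 ^ (k + 1)\<close>, then \<open>p \<le> (k + 1) * n\<close>, and as soon as \<open>(k + 1)\<^sup>3 \<le> p\<close>,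
  cubing yields \<open>p\<^sup>3 \<le> p * n\<^sup>3\<close>. This condition holds for all \<open>p \<ge> 11\<^sup>3 = 1331\<close>: either
  \<open>k \<le> 10\<close>, or \<open>k \<ge> 11\<close> and \<open>(k + 1)\<^sup>3 \<le> 2 ^ k \<le> p\<close>.

  If \<open>p\<^sub>n < 1331\<close>, the inequality is clear for \<open>n > 121\<close>, since \<open>122\<^sup>3 > 1330\<^sup>2\<close>, and the
  remaining cases are read off from the list of the first 121 primes.
\<close>

section \<open>A lower bound for common multiples of an initial segment\<close>

text \<open>
  The numbers \<open>1 / (m * (n choose m))\<close> with \<open>1 \<le> m \<le> n\<close> form Leibniz' harmonic triangle.
  Each entry with \<open>m < n\<close> is the difference of two entries with a smaller value of \<open>n - m\<close>,
  and the entries with \<open>m = n\<close> are the reciprocals \<open>1 / m\<close>. Hence all entries with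
  \<open>n \<le> N\<close> are integer combinations of \<open>1, 1 / 2, \<dots>, 1 / N\<close>.
\<close>

lemma leibniz_triangle:
  fixes m d :: nat
  assumes "m \<ge> 1"
  shows "1 / real (m * (m + Suc d choose m)) =
         1 / real (m * (m + d choose m)) - 1 / real (Suc m * (Suc m + d choose Suc m))"
proof -
  define c where "c = real (m + Suc d choose m)"
  have c: "c > 0"
    by (simp add: c_def)
  have "Suc m * (Suc m + d choose Suc m) = Suc d * (m + Suc d choose m)"
    using Suc_times_binomial_add[of m d] by simp
  then have 1: "real (Suc m * (Suc m + d choose Suc m)) = real (Suc d) * c"
    unfolding c_def by (metis of_nat_mult)
  have "Suc d * (m + Suc d choose m) = (m + Suc d) * (m + d choose m)"
    using \<open>Suc m * _ = Suc d * _\<close> Suc_times_binomial[of m "m + d"] by simp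
  then have 2: "real (m + d choose m) = real (Suc d) * c / real (m + Suc d)"
    unfolding c_def by (simp add: field_simps flip: of_nat_mult)
  have "1 / (real m * c) = 1 / (real m * (real (Suc d) * c / real (m + Suc d))) - 1 / (real (Suc d) * c)"
    using assms c by (simp add: divide_simps)
  then show ?thesis
    using 1 2 by (simp add: c_def)
qed

lemma dvd_imp_mult_binomial_dvd:
  fixes M N n m :: nat
  assumes dvd: "\<And>k. 1 \<le> k \<Longrightarrow> k \<le> N \<Longrightarrow> k dvd M"
    and "1 \<le> m" "m \<le> n" "n \<le> N"
  shows "m * (n choose m) dvd M"
proof -
  have *: "real M / real (m * (m + d choose m)) \<in> \<int>" if "1 \<le> m" "m + d \<le> N" for d m
    using that
  proof (induction d arbitrary: m)
    case 0
    then have "m dvd M"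
      by (intro dvd) auto
    then show ?case
      by (auto elim!: dvdE)
  next
    case (Suc d)
    have "real M / real (m * (m + Suc d choose m)) =
          real M / real (m * (m + d choose m)) - real M / real (Suc m * (Suc m + d choose Suc m))"
      using arg_cong[OF leibniz_triangle[OF Suc.prems(1), of d], of "\<lambda>x. real M * x"]
      by (simp add: right_diff_distrib)
    moreover have "real M / real (m * (m + d choose m)) \<in> \<int>"
      and "real M / real (Suc m * (Suc m + d choose Suc m)) \<in> \<int>"
      using Suc.prems by (intro Suc.IH; simp)+
    ultimately show ?case
      by (metis Ints_diff)
  qed
  have pos: "m * (n choose m) > 0"
    using assms by simp
  have "real M / real (m * (n choose m)) \<in> \<int>"
    using *[of m "n - m"] assms by simp
  then obtain z where "real M / real (m * (n choose m)) = of_int z"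
    by (auto elim: Ints_cases)
  then have "real M = of_int z * real (m * (n choose m))"
    using pos by (simp only: divide_eq_eq)
  then have "int M = z * int (m * (n choose m))"
    by (metis of_int_eq_iff of_int_mult of_int_of_nat_eq)
  then show ?thesis
    by (metis dvd_triv_right int_dvd_int_iff)
qed

lemma two_power_le_common_multiple:
  fixes M N :: nat
  assumes "\<And>k. 1 \<le> k \<Longrightarrow> k \<le> N \<Longrightarrow> k dvd M" "M > 0" "N > 0"
  shows "2 ^ (N - 1) \<le> M"
proof -
  have "N * 2 ^ (N - 1) = (\<Sum>m\<le>N. m * (N choose m))"
    by (simp add: choose_linear_sum)
  also have "\<dots> = (\<Sum>m=1..N. m * (N choose m))"
    by (intro sum.mono_neutral_right) auto
  also have "\<dots> \<le> (\<Sum>m=1..N. M)"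
  proof (rule sum_mono)
    fix m
    assume "m \<in> {1..N}"
    then have "m * (N choose m) dvd M"
      using assms(1) by (intro dvd_imp_mult_binomial_dvd[of N]) auto
    then show "m * (N choose m) \<le> M"
      using \<open>M > 0\<close> by (rule dvd_imp_le)
  qed
  finally show ?thesis
    using \<open>N > 0\<close> by simp
qed

section \<open>A Chebyshev bound\<close>

text \<open>
  The multiple is the least common multiple of \<open>{1..N}\<close>, written as a product over the primes
  \<open>p \<le> N\<close>. Its factor at \<open>p\<close> is the largest power of \<open>p\<close> that divides a number in \<open>{1..N}\<close>,
  so that it does not exceed \<open>N\<close>.
\<close>

lemma exists_common_multiple_le_power_card_primes:
  fixes N :: nat
  assumes "N > 0"
  obtains M where "\<And>k. 1 \<le> k \<Longrightarrow> k \<le> N \<Longrightarrow> k dvd M" "M > 0"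
    "M \<le> N ^ card {p. prime p \<and> p \<le> N}"
proof
  define S where "S = {p. prime p \<and> p \<le> N}"
  define e where "e p = Max (multiplicity p ` {1..N})" for p
  define M where "M = (\<Prod>p\<in>S. p ^ e p)"
  have fin: "finite S"
    by (simp add: S_def)
  have prime: "prime p" if "p \<in> S" for p
    using that by (simp add: S_def)
  show "M > 0"
    using prime by (auto simp: M_def prime_gt_0_nat intro!: prod_pos)
  have "p ^ e p \<le> N" for p
  proof -
    have "e p \<in> multiplicity p ` {1..N}"
      unfolding e_def using assms by (intro Max_in) auto
    then obtain k where "k \<in> {1..N}" "e p = multiplicity p k"
      by auto
    then have "p ^ e p dvd k"
      by (simp add: multiplicity_dvd)
    then have "p ^ e p \<le> k"
      using \<open>k \<in> {1..N}\<close> by (intro dvd_imp_le) auto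
    then show ?thesis
      using \<open>k \<in> {1..N}\<close> by simp
  qed
  then have "M \<le> (\<Prod>p\<in>S. N)"
    unfolding M_def by (intro prod_mono) auto
  then show "M \<le> N ^ card {p. prime p \<and> p \<le> N}"
    by (simp add: S_def)
  show "k dvd M" if k: "1 \<le> k" "k \<le> N" for k
  proof (rule multiplicity_le_imp_dvd)
    show "k \<noteq> 0"
      using k by simp
    fix p :: nat
    assume p: "prime p"
    show "multiplicity p k \<le> multiplicity p M"
    proof (cases "p dvd k")
      case True
      then have "p \<le> k"
        using k by (intro dvd_imp_le) auto
      with k have "p \<le> N"
        by simp
      with p have "p \<in> S"
        by (simp add: S_def)
      then have "multiplicity p M = e p"
        unfolding M_def using p prime fin by (subst multiplicity_prod_prime_powers) auto
      moreover have "multiplicity p k \<le> e p"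
        unfolding e_def using k by (intro Max_ge) auto
      ultimately show ?thesis
        by simp
    qed (simp add: not_dvd_imp_multiplicity_0)
  qed
qed

lemma two_power_le_power_card_primes:
  fixes N :: nat
  assumes "N > 0"
  shows "2 ^ (N - 1) \<le> N ^ card {p. prime p \<and> p \<le> N}"
proof -
  obtain M where "\<And>k. 1 \<le> k \<Longrightarrow> k \<le> N \<Longrightarrow> k dvd M" "M > 0"
    and M: "M \<le> N ^ card {p. prime p \<and> p \<le> N}"
    using exists_common_multiple_le_power_card_primes[OF assms] by metis
  then have "2 ^ (N - 1) \<le> M"
    using assms by (intro two_power_le_common_multiple) auto
  with M show ?thesis
    by (rule order_trans[rotated])
qed

lemma prime_nth_prime: "n \<ge> 1 \<Longrightarrow> prime (nth_prime n)"
  using nth_prime_image by blast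

lemma card_primes_le_nth_prime:
  assumes "n \<ge> 1"
  shows "card {p. prime p \<and> p \<le> nth_prime n} \<le> n"
proof -
  have "{p. prime p \<and> p \<le> nth_prime n} \<subseteq> nth_prime ` {1..n}"
  proof clarify
    fix p :: nat
    assume "prime p" and le: "p \<le> nth_prime n"
    then have "p \<in> nth_prime ` {1..}"
      by (simp only: nth_prime_image mem_Collect_eq)
    then obtain m where m: "m \<ge> 1" "p = nth_prime m"
      by auto
    have "m \<le> n"
      using le m assms strict_mono_onD[OF strict_mono_on_nth_prime, of n m] by force
    with m show "p \<in> nth_prime ` {1..n}"
      by auto
  qed
  then have "card {p. prime p \<and> p \<le> nth_prime n} \<le> card (nth_prime ` {1..n})"
    by (intro card_mono) auto
  also have "\<dots> \<le> n"
    using card_image_le[of "{1..n}" nth_prime] by simp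
  finally show ?thesis .
qed

lemma two_power_nth_prime_le:
  assumes "n \<ge> 1"
  shows "2 ^ (nth_prime n - 1) \<le> nth_prime n ^ n"
proof -
  have "nth_prime n > 0"
    using prime_nth_prime[OF assms] by (rule prime_gt_0_nat)
  then have "2 ^ (nth_prime n - 1) \<le> nth_prime n ^ card {p. prime p \<and> p \<le> nth_prime n}"
    by (rule two_power_le_power_card_primes)
  also have "\<dots> \<le> nth_prime n ^ n"
    using \<open>nth_prime n > 0\<close> card_primes_le_nth_prime[OF assms] by (intro power_increasing) auto
  finally show ?thesis .
qed

section \<open>The inequality between the square of a prime and the cube of its index\<close>

lemma Suc_cube_le_two_power:
  fixes k :: nat
  assumes "k \<ge> 11"
  shows "(k + 1) ^ 3 \<le> 2 ^ k"
  using assms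
proof (induction k rule: nat_induct_at_least)
  case (Suc k)
  have "11 * k \<le> k * k"
    using Suc.hyps by (intro mult_right_mono) auto
  moreover have "11 * (k * k) \<le> k * (k * k)"
    using Suc.hyps by (intro mult_right_mono) auto
  moreover have "(Suc k + 1) ^ 3 = k * (k * k) + 6 * (k * k) + 12 * k + 8"
    and "2 * (k + 1) ^ 3 = 2 * (k * (k * k)) + 6 * (k * k) + 6 * k + 2"
    by (simp_all add: power3_eq_cube algebra_simps)
  ultimately have "(Suc k + 1) ^ 3 \<le> 2 * (k + 1) ^ 3"
    using Suc.hyps by linarith
  with Suc.IH show ?case
    by simp
qed simp

lemma nth_prime_square_le_cube_of_large:
  assumes "n \<ge> 1" and large: "nth_prime n \<ge> 1331"
  shows "(nth_prime n)\<^sup>2 \<le> n ^ 3"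
proof -
  define p where "p = nth_prime n"
  have p: "p \<ge> 1331"
    using large by (simp add: p_def)
  \<comment> \<open>The integer part of the binary logarithm replaces the logarithm of \<open>p\<close>.\<close>
  obtain k where k: "2 ^ k \<le> p" "p < 2 ^ (k + 1)"
    using ex_power_ivl1[of 2 p] p by auto
  have "(2::nat) ^ (p - 1) \<le> p ^ n"
    using two_power_nth_prime_le[OF \<open>n \<ge> 1\<close>] by (simp add: p_def)
  also have "\<dots> < (2 ^ (k + 1)) ^ n"
    using k \<open>n \<ge> 1\<close> by (intro power_strict_mono) auto
  also have "\<dots> = 2 ^ ((k + 1) * n)"
    by (rule power_mult[symmetric])
  finally have "p - 1 < (k + 1) * n"
    by (rule power_less_imp_less_exp[rotated]) simp
  then have "p \<le> (k + 1) * n"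
    by simp
  moreover have "(k + 1) ^ 3 \<le> p"
  proof (cases "k \<ge> 11")
    case True
    then show ?thesis
      using Suc_cube_le_two_power[of k] k by simp
  next
    case False
    then have "(k + 1) ^ 3 \<le> 11 ^ 3"
      by (intro power_mono) auto
    then show ?thesis
      using p by simp
  qed
  ultimately have "p ^ 3 \<le> ((k + 1) * n) ^ 3" and "(k + 1) ^ 3 * n ^ 3 \<le> p * n ^ 3"
    by (intro power_mono mult_right_mono; simp)+
  then have "p ^ 3 \<le> p * n ^ 3"
    by (simp only: power_mult_distrib)
  then have "p * p\<^sup>2 \<le> p * n ^ 3"
    by (simp add: power2_eq_square power3_eq_cube mult.assoc)
  then show ?thesis
    using p by (simp add: p_def)
qed

text \<open>
  The \<open>i\<close>-th smallest element of \<open>S\<close> is at most the \<open>i\<close>-th entry of any strictly increasing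
  list of elements of \<open>S\<close>, because elements of \<open>S\<close> may be missing from the list.
\<close>

lemma enumerate_le_nth:
  fixes S :: "nat set"
  assumes "infinite S" "sorted_wrt (<) xs" "set xs \<subseteq> S" "i < length xs"
  shows "enumerate S i \<le> xs ! i"
  using \<open>i < length xs\<close>
proof (induction i)
  case 0
  then have "xs ! 0 \<in> S"
    using assms by (meson nth_mem subsetD)
  then show ?case
    by (simp add: enumerate_0 Least_le)
next
  case (Suc i)
  then have "xs ! Suc i \<in> S" "xs ! i < xs ! Suc i"
    using assms by (auto simp: sorted_wrt_iff_nth_less)
  with Suc show ?case
    using \<open>infinite S\<close> by (simp add: enumerate_Suc'' Least_le)
qed

text \<open>
  The first 121 primes. That the entries are primes in increasing order already makes the entry
  at position \<open>i\<close>, counted from 0, an upper bound for the prime with index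
  \<open>i + 1\<close>; completeness of the list is not needed.
\<close>

definition first_primes :: "nat list" where
  "first_primes =
    [2, 3, 5, 7, 11, 13, 17, 19, 23, 29, 31, 37, 41, 43, 47, 53, 59, 61, 67, 71, 73,
     79, 83, 89, 97, 101, 103, 107, 109, 113, 127, 131, 137, 139, 149, 151, 157, 163,
     167, 173, 179, 181, 191, 193, 197, 199, 211, 223, 227, 229, 233, 239, 241, 251,
     257, 263, 269, 271, 277, 281, 283, 293, 307, 311, 313, 317, 331, 337, 347, 349,
     353, 359, 367, 373, 379, 383, 389, 397, 401, 409, 419, 421, 431, 433, 439, 443,
     449, 457, 461, 463, 467, 479, 487, 491, 499, 503, 509, 521, 523, 541, 547, 557,
     563, 569, 571, 577, 587, 593, 599, 601, 607, 613, 617, 619, 631, 641, 643, 647,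
     653, 659, 661]"

lemma length_first_primes: "length first_primes = 121"
  by (simp add: first_primes_def)

lemma sorted_first_primes: "sorted_wrt (<) first_primes"
  unfolding first_primes_def
  by (subst successively_conv_sorted_wrt[symmetric]) (auto intro: transpI)

lemma prime_nat_if_no_prime_factor_upto_sqrt:
  fixes m :: nat
  assumes "m > 1" and no_factor: "\<And>q. prime q \<Longrightarrow> q\<^sup>2 \<le> m \<Longrightarrow> \<not> q dvd m"
  shows "prime m"
proof (rule ccontr)
  assume "\<not> prime m"
  then obtain a where "a dvd m" "a \<noteq> 1" "a \<noteq> m"
    using \<open>m > 1\<close> by (auto simp: prime_nat_iff)
  then obtain b where ab: "m = a * b" "a > 1" "b > 1"
    using \<open>m > 1\<close> by (auto elim!: dvdE simp: nat_neq_iff)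
  define c where "c = min a b"
  have c: "c \<noteq> 1" "c > 0" "c dvd m" "c\<^sup>2 \<le> m"
    using ab by (auto simp: c_def min_def power2_eq_square)
  obtain q where q: "prime q" "q dvd c"
    using prime_factor_nat[OF \<open>c \<noteq> 1\<close>] by blast
  then have "q\<^sup>2 \<le> c\<^sup>2"
    using c by (intro power_mono dvd_imp_le) auto
  then have "q\<^sup>2 \<le> m"
    using c by (blast intro: order_trans)
  moreover have "q dvd m"
    using q c by (blast intro: dvd_trans)
  ultimately show False
    using no_factor q by blast
qed

text \<open>
  Trial division by the primes below 29 decides primality below \<open>29\<^sup>2 = 841\<close>, which covers the
  table.
\<close>

lemma prime_nat_lt_29_cases:
  fixes q :: nat
  assumes "prime q" "q < 29"
  shows "q \<in> {2, 3, 5, 7, 11, 13, 17, 19, 23}"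
proof -
  have "q \<in> set [2..<29]"
    unfolding set_upt using assms prime_ge_2_nat by simp
  then show ?thesis
    using \<open>prime q\<close> by auto
qed

lemma prime_nat_lt_841:
  fixes m :: nat
  assumes "1 < m" "m < 841"
    and no_factor: "\<forall>q\<in>{2, 3, 5, 7, 11, 13, 17, 19, 23}. q dvd m \<longrightarrow> q = m"
  shows "prime m"
proof (rule prime_nat_if_no_prime_factor_upto_sqrt)
  fix q :: nat
  assume q: "prime q" "q\<^sup>2 \<le> m"
  have "q\<^sup>2 < 29\<^sup>2"
    using q \<open>m < 841\<close> by simp
  then have "q < 29"
    by (rule power_less_imp_less_base) simp
  with no_factor q have "q dvd m \<longrightarrow> q = m"
    using prime_nat_lt_29_cases by blast
  moreover have "q < q\<^sup>2"
    using prime_gt_1_nat[OF \<open>prime q\<close>] by (simp add: power2_eq_square)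
  ultimately show "\<not> q dvd m"
    using q by auto
qed (fact assms)

lemma prime_first_primes: "\<forall>p\<in>set first_primes. prime p"
proof -
  have "\<forall>p\<in>set first_primes. 1 < p \<and> p < 841 \<and>
          (\<forall>q\<in>{2, 3, 5, 7, 11, 13, 17, 19, 23}. q dvd p \<longrightarrow> q = p)"
    unfolding first_primes_def by simp
  then show ?thesis
    by (blast intro: prime_nat_lt_841)
qed

lemma first_primes_square_le_cube:
  "list_all2 (\<lambda>p n. p\<^sup>2 \<le> n ^ 3) (drop 2 first_primes) [3..<122]"
  unfolding first_primes_def by simp

lemma nth_prime_square_le_cube:
  assumes "n \<ge> 3"
  shows "(nth_prime n)\<^sup>2 \<le> n ^ 3"
proof (cases "nth_prime n \<ge> 1331")
  case True
  then show ?thesis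
    using assms by (intro nth_prime_square_le_cube_of_large) auto
next
  case small: False
  show ?thesis
  proof (cases "n \<le> 121")
    case True
    have "n - 1 = 2 + (n - 3)"
      using assms by simp
    then have "first_primes ! (n - 1) = drop 2 first_primes ! (n - 3)"
      using assms True by (simp add: length_first_primes)
    moreover have "[3..<122] ! (n - 3) = n"
      using assms True by (subst nth_upt) auto
    ultimately have "(first_primes ! (n - 1))\<^sup>2 \<le> n ^ 3"
      using list_all2_nthD[OF first_primes_square_le_cube, of "n - 3"] assms True
      by (simp add: length_first_primes)
    moreover have "nth_prime n \<le> first_primes ! (n - 1)"
      unfolding nth_prime_def
      using primes_infinite sorted_first_primes prime_first_primes assms True
      by (intro enumerate_le_nth) (auto simp: length_first_primes)
    ultimately show ?thesis
      by (meson le_trans power_mono zero_le)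
  next
    case False
    have "(nth_prime n)\<^sup>2 \<le> 1330\<^sup>2"
      using small by (intro power_mono) auto
    also have "\<dots> \<le> (122::nat) ^ 3"
      by simp
    also have "\<dots> \<le> n ^ 3"
      using False by (intro power_mono) auto
    finally show ?thesis .
  qed
qed

section \<open>The power bound\<close>

lemma nth_prime_2: "nth_prime 2 = 3"
proof -
  have "nth_prime 2 \<le> 3"
    using enumerate_le_nth[of "{p. prime p}" "[2, 3]" 1] primes_infinite
    by (simp add: nth_prime_def)
  moreover have "nth_prime 1 < nth_prime 2"
    by (rule strict_mono_onD[OF strict_mono_on_nth_prime]) auto
  ultimately show ?thesis
    using nth_prime_1 by simp
qed

theorem proposition1p4:
  fixes n :: nat
  assumes "n \<ge> 2"
  shows "real (nth_prime n) \<le> real n powr (ln 3 / ln 2)"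
proof (cases "n = 2")
  case True
  then show ?thesis
    by (simp add: nth_prime_2 powr_def)
next
  case False
  with assms have n: "n \<ge> 3"
    by simp
  have "(real (nth_prime n))\<^sup>2 \<le> real n ^ 3"
    using nth_prime_square_le_cube[OF n] by (metis of_nat_le_iff of_nat_power)
  also have "\<dots> = (real n powr (3 / 2))\<^sup>2"
    using n by (simp add: power2_eq_square flip: powr_add)
  finally have "real (nth_prime n) \<le> real n powr (3 / 2)"
    by (rule power2_le_imp_le) simp
  also have "\<dots> \<le> real n powr (ln 3 / ln 2)"
  proof (rule powr_mono)
    have "ln ((2::real) ^ 3) \<le> ln (3 ^ 2)"
      by (subst ln_le_cancel_iff) auto
    then have "3 * ln (2::real) \<le> 2 * ln 3"
      by (simp only: ln_realpow of_nat_numeral)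
    then show "3 / 2 \<le> ln 3 / ln (2::real)"
      by (simp add: field_simps)
  qed (use n in simp)
  finally show ?thesis .
qed

end
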